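(* Let $\mathbf{k}$ be a field of characteristic zero, $n\ge 1$, and $m_1,\dots,m_n\ge 2$ integers. Then the monomial complete intersection $\mathbf{k}[x_1,\dots,x_n]/(x_1^{m_1},\dots,x_n^{m_n})$ has the strong Lefschetz property.
   Context: A standard graded Artinian algebra $A=\mathbf{k}[x_1,\dots,x_n]/I$ ($I$ a homogeneous ideal) has the strong Lefschetz property if, for a general linear form $\ell$ (equivalently, for some linear form $\ell$), all multiplication maps $A_d\to A_{d+e}$, $f\mapsto\ell^e f$, with $d,e\ge 0$, have maximal rank (i.e. are injective or surjective). If $I$ is a monomial ideal it is equivalent to require this for $\ell=x_1+\cdots+x_n$. *)

theory Defs
  imports "HOL-Library.Poly_Mapping" "HOL-Algebra.QuotRing"
begin

text \<open>
  A monomial is a finitely supported exponent vector, and a polynomial is a finitely supported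
  family of coefficients indexed by monomials. The convolution product of
  \<^theory>\<open>HOL-Library.Poly_Mapping\<close> is then polynomial multiplication.
\<close>

type_synonym monomial = "nat \<Rightarrow>\<^sub>0 nat"
type_synonym 'a mpoly = "monomial \<Rightarrow>\<^sub>0 'a"

definition poly_ring :: "nat \<Rightarrow> 'a::comm_ring_1 mpoly ring" where
  "poly_ring n =
    \<lparr>carrier = {f. \<forall>t\<in>Poly_Mapping.keys f. Poly_Mapping.keys t \<subseteq> {1..n}},
     mult = (*), one = 1, zero = 0, add = (+)\<rparr>"

definition var_power :: "nat \<Rightarrow> nat \<Rightarrow> 'a::comm_ring_1 mpoly" where
  "var_power i k = Poly_Mapping.single (Poly_Mapping.single i k) 1"

definition linear_form :: "nat \<Rightarrow> (nat \<Rightarrow> 'a) \<Rightarrow> 'a::comm_ring_1 mpoly" where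
  "linear_form n a = (\<Sum>i\<in>{1..n}. Poly_Mapping.single (Poly_Mapping.single i 1) (a i))"

definition total_degree :: "monomial \<Rightarrow> nat" where
  "total_degree t = (\<Sum>i\<in>Poly_Mapping.keys t. Poly_Mapping.lookup t i)"

text \<open>The zero polynomial is homogeneous of every degree.\<close>

definition homogeneous :: "nat \<Rightarrow> 'a::comm_ring_1 mpoly \<Rightarrow> bool" where
  "homogeneous d f \<longleftrightarrow> (\<forall>t\<in>Poly_Mapping.keys f. total_degree t = d)"

definition eval_poly :: "(nat \<Rightarrow> 'a) \<Rightarrow> 'a::comm_ring_1 mpoly \<Rightarrow> 'a" where
  "eval_poly a f =
    (\<Sum>t\<in>Poly_Mapping.keys f. Poly_Mapping.lookup f t *
      (\<Prod>i\<in>Poly_Mapping.keys t. a i ^ Poly_Mapping.lookup t i))"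

definition graded_piece :: "nat \<Rightarrow> 'a::comm_ring_1 mpoly set \<Rightarrow> nat \<Rightarrow> 'a mpoly set set" where
  "graded_piece n I d =
    {I +>\<^bsub>poly_ring n\<^esub> f | f. f \<in> carrier (poly_ring n) \<and> homogeneous d f}"

definition maximal_rank :: "('b \<Rightarrow> 'c) \<Rightarrow> 'b set \<Rightarrow> 'c set \<Rightarrow> bool" where
  "maximal_rank \<phi> V W \<longleftrightarrow> inj_on \<phi> V \<or> \<phi> ` V = W"

definition strong_lefschetz_element ::
    "nat \<Rightarrow> 'a::comm_ring_1 mpoly set \<Rightarrow> 'a mpoly \<Rightarrow> bool" where
  "strong_lefschetz_element n I l \<longleftrightarrow>
    (let A = poly_ring n Quot I in
      \<forall>d e. maximal_rank
        (\<lambda>u. ((I +>\<^bsub>poly_ring n\<^esub> l) [^]\<^bsub>A\<^esub> (e::nat)) \<otimes>\<^bsub>A\<^esub> u)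
        (graded_piece n I d) (graded_piece n I (d + e)))"

text \<open>
  A property holds for a general linear form if it holds on a nonempty Zariski open subset of the
  space of linear forms, parametrised by coefficient vectors. Every nonempty Zariski open set
  contains a nonempty basic open set, the locus where some polynomial \<open>F\<close> in the coefficients does
  not vanish, so it suffices to speak about the latter. Nonemptiness is required explicitly, so
  that in particular some linear form has the property.
\<close>

definition for_general_linear_form ::
    "nat \<Rightarrow> ('a::comm_ring_1 mpoly \<Rightarrow> bool) \<Rightarrow> bool" where
  "for_general_linear_form n P \<longleftrightarrow>
    (\<exists>F\<in>carrier (poly_ring n).
      (\<exists>a. eval_poly a F \<noteq> 0) \<and>
      (\<forall>a. eval_poly a F \<noteq> 0 \<longrightarrow> P (linear_form n a)))"

text \<open>
  The strong Lefschetz property of the algebra \<open>poly_ring n Quot I\<close>, for a homogeneous ideal \<open>I\<close>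
  with Artinian quotient.
\<close>

definition strong_lefschetz_property :: "nat \<Rightarrow> 'a::field mpoly set \<Rightarrow> bool" where
  "strong_lefschetz_property n I \<longleftrightarrow>
    for_general_linear_form n (strong_lefschetz_element n I)"

definition monomial_ci_ideal :: "nat \<Rightarrow> (nat \<Rightarrow> nat) \<Rightarrow> 'a::comm_ring_1 mpoly set" where
  "monomial_ci_ideal n m = Idl\<^bsub>poly_ring n\<^esub> {var_power i (m i) | i. i \<in> {1..n}}"

lemma cring_poly_ring: "cring (poly_ring n :: 'a::comm_ring_1 mpoly ring)"
proof (rule cringI)
  have add_cl: "f + g \<in> carrier (poly_ring n)"
    if "f \<in> carrier (poly_ring n)" "g \<in> carrier (poly_ring n)" for f g :: "'a mpoly"
    using that Poly_Mapping.keys_add[of f g] unfolding poly_ring_def by auto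
  have mult_cl: "f * g \<in> carrier (poly_ring n)"
    if f: "f \<in> carrier (poly_ring n)" and g: "g \<in> carrier (poly_ring n)" for f g :: "'a mpoly"
  proof -
    have "Poly_Mapping.keys t \<subseteq> {1..n}" if t: "t \<in> Poly_Mapping.keys (f * g)" for t
    proof -
      obtain r s where rs: "t = r + s" "r \<in> Poly_Mapping.keys f" "s \<in> Poly_Mapping.keys g"
        using t Poly_Mapping.keys_mult[of f g] by blast
      then have "Poly_Mapping.keys r \<subseteq> {1..n}" "Poly_Mapping.keys s \<subseteq> {1..n}"
        using f g by (auto simp: poly_ring_def)
      then show ?thesis
        using rs(1) Poly_Mapping.keys_add[of r s] by blast
    qed
    then show ?thesis by (simp add: poly_ring_def)
  qed
  have zero_cl: "0 \<in> carrier (poly_ring n :: 'a mpoly ring)"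
    and one_cl: "1 \<in> carrier (poly_ring n :: 'a mpoly ring)"
    by (simp_all add: poly_ring_def)
  have ops: "x \<oplus>\<^bsub>poly_ring n\<^esub> y = x + y" "x \<otimes>\<^bsub>poly_ring n\<^esub> y = x * y"
    "\<zero>\<^bsub>poly_ring n\<^esub> = (0 :: 'a mpoly)" "\<one>\<^bsub>poly_ring n\<^esub> = (1 :: 'a mpoly)"
    for x y :: "'a mpoly"
    by (simp_all add: poly_ring_def)
  show "abelian_group (poly_ring n :: 'a mpoly ring)"
  proof (rule abelian_groupI, unfold ops)
    fix f :: "'a mpoly"
    assume "f \<in> carrier (poly_ring n)"
    then have "- f \<in> carrier (poly_ring n)"
      by (simp add: poly_ring_def)
    then show "\<exists>g\<in>carrier (poly_ring n). g + f = 0"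
      by (intro bexI[of _ "- f"]) simp_all
  qed (simp_all add: add_cl zero_cl ac_simps)
  show "comm_monoid (poly_ring n :: 'a mpoly ring)"
    by (rule comm_monoidI, unfold ops) (simp_all add: mult_cl one_cl ac_simps)
  show "(x \<oplus>\<^bsub>poly_ring n\<^esub> y) \<otimes>\<^bsub>poly_ring n\<^esub> z =
      x \<otimes>\<^bsub>poly_ring n\<^esub> z \<oplus>\<^bsub>poly_ring n\<^esub> y \<otimes>\<^bsub>poly_ring n\<^esub> z" for x y z :: "'a mpoly"
    by (simp add: ops distrib_right)
qed

lemma ideal_monomial_ci_ideal:
  "ideal (monomial_ci_ideal n m :: 'a::comm_ring_1 mpoly set) (poly_ring n)"
proof -
  interpret cring "poly_ring n :: 'a mpoly ring" by (rule cring_poly_ring)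
  show ?thesis
    unfolding monomial_ci_ideal_def
    by (rule genideal_ideal) (auto simp: poly_ring_def var_power_def split: if_splits)
qed

end

theory Submission
  imports Defs HOL.Vector_Spaces
begin

text \<open>
  Let \<open>l = a\<^sub>1 x\<^sub>1 + \<dots> + a\<^sub>n x\<^sub>n\<close> with all \<open>a\<^sub>i \<noteq> 0\<close> and \<open>s = \<Sum>\<^sub>i (m\<^sub>i - 1)\<close>. Multiplication \<open>E\<close> by \<open>l\<close> and
  the operator \<open>F\<close> sending \<open>x\<^sup>t\<close> to \<open>\<Sum>\<^sub>i (t\<^sub>i (m\<^sub>i - t\<^sub>i) / a\<^sub>i) x\<^sup>t / x\<^sub>i\<close> preserve the ideal
  and form an \<open>sl\<^sub>2\<close>-pair on the polynomial ring: \<open>E F - F E\<close> is multiplication by \<open>2 d - s\<close> in degree \<open>d\<close>. The quotient vanishes in degrees above \<open>s\<close>. In characteristic zero these relations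
  alone force \<open>E\<^sup>e\<close> from degree \<open>d\<close> to be injective modulo the ideal if \<open>2 d + e \<le> s\<close> and
  surjective if \<open>2 d + e \<ge> s\<close>, without any count of dimensions.
\<close>

section \<open>The abstract argument for an sl_2-pair modulo a stable subspace\<close>

text \<open>\<open>G d\<close> stands for the piece of degree \<open>d\<close> and \<open>I\<close>
  for the ideal. All statements concern representatives modulo \<open>I\<close>, so no quotient
  space is formed. \<open>F_G_0\<close> replaces a zero piece in degree -1.\<close>

locale lefschetz_sl2 =
  vector_space scale +
  E: Vector_Spaces.linear scale scale E + F: Vector_Spaces.linear scale scale F
  for scale :: "'k::field_char_0 \<Rightarrow> 'v::ab_group_add \<Rightarrow> 'v" and E F :: "'v \<Rightarrow> 'v" +
  fixes G :: "nat \<Rightarrow> 'v set" and I :: "'v set" and s :: nat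
  assumes subspace_G: "subspace (G d)"
    and subspace_I: "subspace I"
    and E_I: "v \<in> I \<Longrightarrow> E v \<in> I"
    and F_I: "v \<in> I \<Longrightarrow> F v \<in> I"
    and E_G: "v \<in> G d \<Longrightarrow> E v \<in> G (Suc d)"
    and F_G: "v \<in> G (Suc d) \<Longrightarrow> F v \<in> G d"
    and F_G_0: "v \<in> G 0 \<Longrightarrow> F v = 0"
    and commutator: "v \<in> G d \<Longrightarrow> E (F v) - F (E v) = scale (2 * of_nat d - of_nat s) v"
    and G_subset_I: "s < d \<Longrightarrow> G d \<subseteq> I"
begin

lemma E_pow_add: "(E ^^ e) (v + w) = (E ^^ e) v + (E ^^ e) w"
  by (induction e) (simp_all add: E.add)

lemma E_pow_diff: "(E ^^ e) (v - w) = (E ^^ e) v - (E ^^ e) w"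
  by (induction e) (simp_all add: E.diff)

lemma E_pow_scale: "(E ^^ e) (scale c v) = scale c ((E ^^ e) v)"
  by (induction e) (simp_all add: E.scale)

lemma E_pow_zero: "(E ^^ e) 0 = 0"
  by (induction e) simp_all

lemma E_pow_G: "v \<in> G d \<Longrightarrow> (E ^^ e) v \<in> G (d + e)"
  by (induction e) (auto intro: E_G)

lemma E_pow_I: "v \<in> I \<Longrightarrow> (E ^^ e) v \<in> I"
  by (induction e) (auto intro: E_I)

text \<open>Moving \<open>F\<close> past the factors \<open>E\<close> one at a time picks up the
  weights \<open>2 * (d + j) - s\<close> for j = 0, ..., e, which add up to the coefficient.\<close>

lemma E_pow_commutator:
  assumes "v \<in> G d"
  shows "(E ^^ Suc e) (F v) - F ((E ^^ Suc e) v) =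
    scale (of_nat (Suc e) * (2 * of_nat d - of_nat s + of_nat e)) ((E ^^ e) v)"
proof (induction e)
  case 0
  then show ?case using commutator[OF assms] by simp
next
  case (Suc e)
  let ?w = "(E ^^ Suc e) v"
  have "(E ^^ Suc (Suc e)) (F v) - F ((E ^^ Suc (Suc e)) v) =
      E ((E ^^ Suc e) (F v) - F ?w) + (E (F ?w) - F (E ?w))"
    by (simp add: E.diff)
  also have "E ((E ^^ Suc e) (F v) - F ?w) =
      scale (of_nat (Suc e) * (2 * of_nat d - of_nat s + of_nat e)) ?w"
    unfolding Suc.IH by (simp add: E.scale)
  also have "E (F ?w) - F (E ?w) = scale (2 * of_nat (d + Suc e) - of_nat s) ?w"
    by (rule commutator[OF E_pow_G[OF assms]])
  finally show ?case
    unfolding scale_left_distrib[symmetric] by (simp add: algebra_simps del: funpow.simps)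
qed

lemma of_nat_diff_add_nonzero:
  assumes "a + b \<noteq> s"
  shows "of_nat a - of_nat s + of_nat b \<noteq> (0 :: 'k)"
proof
  assume "of_nat a - of_nat s + of_nat b = (0 :: 'k)"
  then have "of_nat (a + b) = (of_nat s :: 'k)" by (simp add: algebra_simps)
  with assms show False unfolding of_nat_eq_iff by simp
qed

text \<open>The element in \<open>U\<close> is a multiple of \<open>(E ^^ e) v\<close>, and
  characteristic zero makes both factors of the coefficient nonzero. \<open>U\<close> is left
  general: it is \<open>I\<close> for injectivity and the image of a power of \<open>E\<close>
  modulo \<open>I\<close> for surjectivity.\<close>

lemma E_pow_commutator_cancel:
  assumes v: "v \<in> G d" and "2 * d + e \<noteq> s"
    and U: "subspace U" "(E ^^ Suc e) (F v) - F ((E ^^ Suc e) v) \<in> U"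
  shows "(E ^^ e) v \<in> U"
proof -
  define c :: 'k where "c = of_nat (Suc e) * (2 * of_nat d - of_nat s + of_nat e)"
  have "c \<noteq> 0"
    using of_nat_diff_add_nonzero[OF assms(2)] by (simp add: c_def del: of_nat_Suc)
  moreover have "scale c ((E ^^ e) v) \<in> U"
    using U(2) unfolding E_pow_commutator[OF v] c_def .
  ultimately show ?thesis
    using subspace_scale[OF U(1), of "scale c ((E ^^ e) v)" "inverse c"] by simp
qed

text \<open>Modulo \<open>I\<close>, \<open>v\<close> is a lowest weight vector. Powers of
  \<open>E\<close> are cancelled one by one: \<open>2 * d + Suc e \<le> s\<close> gives
  \<open>2 * d + e < s\<close>, so no coefficient met on the way vanishes.\<close>

lemma E_pow_inj_mod_if_F_mem:
  assumes v: "v \<in> G d" and "2 * d + e \<le> s" "(E ^^ e) v \<in> I" "F v \<in> I"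
  shows "v \<in> I"
  using assms(2,3)
proof (induction e)
  case (Suc e)
  have "(E ^^ Suc e) (F v) - F ((E ^^ Suc e) v) \<in> I"
    by (intro subspace_diff[OF subspace_I] E_pow_I F_I \<open>F v \<in> I\<close> Suc.prems)
  then have "(E ^^ e) v \<in> I"
    using Suc.prems by (intro E_pow_commutator_cancel[OF v _ subspace_I]) auto
  then show ?case using Suc by simp
qed simp

text \<open>The commutator relation puts \<open>(E ^^ Suc e) (F v)\<close> into \<open>I\<close>.
  The bound survives trading one degree for one more factor \<open>E\<close>, so induction on the
  degree gives \<open>F v \<in> I\<close>, the lowest weight case.\<close>

lemma E_pow_inj_mod:
  "v \<in> G d \<Longrightarrow> 2 * d + e \<le> s \<Longrightarrow> (E ^^ e) v \<in> I \<Longrightarrow> v \<in> I"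
proof (induction d arbitrary: v e)
  case 0
  then show ?case
    using E_pow_inj_mod_if_F_mem[OF 0] F_G_0 subspace_0[OF subspace_I] by simp
next
  case (Suc d)
  have "F ((E ^^ Suc e) v) + scale (of_nat (Suc e) * (2 * of_nat (Suc d) - of_nat s + of_nat e)) ((E ^^ e) v) \<in> I"
    using Suc.prems(3)
    by (intro subspace_add[OF subspace_I] subspace_scale[OF subspace_I] F_I) (simp_all add: E_I)
  then have "(E ^^ Suc e) (F v) \<in> I"
    unfolding E_pow_commutator[OF Suc.prems(1), symmetric] by simp
  then have "F v \<in> I"
    using Suc.prems by (intro Suc.IH[of "F v" "Suc e", OF F_G]) simp_all
  then show ?case using E_pow_inj_mod_if_F_mem Suc.prems by blast
qed

text \<open>
  Modulo \<open>I\<close>: by induction on \<open>e\<close>, \<open>w\<close> is \<open>E\<^sup>e\<^sup>-\<^sup>1 u\<close>, and by downward induction on the degree \<open>E w\<close> is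
  \<open>E\<^sup>e\<^sup>+\<^sup>2 y\<close>. For \<open>u' = u - E\<^sup>2 y\<close> this gives \<open>E\<^sup>e u' = 0\<close>, and the commutator relation turns \<open>E\<^sup>e (F u')\<close>
  into a nonzero multiple of \<open>E\<^sup>e\<^sup>-\<^sup>1 u'\<close>.
\<close>

lemma E_pow_surj_mod:
  "w \<in> G (d + e) \<Longrightarrow> s \<le> 2 * d + e \<Longrightarrow> \<exists>u\<in>G d. w - (E ^^ e) u \<in> I"
proof (induction "Suc s - (d + e)" arbitrary: w d e)
  \<comment> \<open>The truncated measure is zero exactly when \<open>d + e\<close> exceeds
    \<open>s\<close>; then \<open>0\<close> is a preimage modulo \<open>I\<close>.\<close>
  case 0
  then have "w \<in> I" using G_subset_I[of "d + e"] by auto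
  then show ?case
    using subspace_0[OF subspace_G] by (intro bexI[of _ 0]) (simp_all add: E_pow_zero)
next
  case (Suc k)
  note IH_degree = Suc.hyps(1) and deg = Suc.hyps(2)
  show ?case
    using Suc.prems deg
  proof (induction e arbitrary: d)
    case 0
    then show ?case using subspace_0[OF subspace_I] by (intro bexI[of _ w]) simp_all
  next
    case (Suc e)
    \<comment> \<open>Raising \<open>d\<close> while lowering the exponent keeps the total degree,
      hence the outer measure, and the bound still holds.\<close>
    obtain u where u: "u \<in> G (Suc d)" "w - (E ^^ e) u \<in> I"
      using Suc.IH[of "Suc d"] Suc.prems by auto
    have Ew: "E w \<in> G (d + (e + 2))"
      using E_G[OF Suc.prems(1)] by simp
    have Eu: "E w - (E ^^ Suc e) u \<in> I"
      using E_I[OF u(2)] by (simp add: E.diff)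
    \<comment> \<open>\<open>z\<close> is \<open>E y\<close>, with \<open>y\<close> from the outer
      induction hypothesis one degree below \<open>d\<close> and exponent \<open>e + 3\<close>. For
      \<open>d = 0\<close> there is no such degree, but then \<open>E w\<close> has degree above
      \<open>s\<close> and \<open>z = 0\<close> works.\<close>
    obtain z where z: "z \<in> G d" "E z \<in> G (Suc d)" "E w - (E ^^ Suc e) (E z) \<in> I"
    proof (cases d)
      case 0
      with Suc.prems Ew have "E w \<in> I" using G_subset_I[of "d + (e + 2)"] by auto
      then show ?thesis
        using that[of 0] subspace_0[OF subspace_G] by (simp add: E_pow_zero)
    next
      case (Suc d')
      let ?n = "Suc (Suc (Suc e))"
      have eq: "d' + ?n = d + (e + 2)" using Suc by simp
      have "k = Suc s - (d' + ?n)" "s \<le> 2 * d' + ?n"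
        using Suc.prems Suc by simp_all
      then obtain y where y: "y \<in> G d'" "E w - (E ^^ ?n) y \<in> I"
        using IH_degree[of d' ?n "E w"] Ew unfolding eq by blast
      have "(E ^^ ?n) y = (E ^^ Suc e) (E (E y))"
        by (simp only: funpow_Suc_right o_apply)
      then show ?thesis
        using that[of "E y"] y E_G Suc by (simp del: funpow.simps)
    qed
    define u' where "u' = u - E z"
    have u': "u' \<in> G (Suc d)"
      unfolding u'_def by (intro subspace_diff[OF subspace_G] u z)
    \<comment> \<open>The elements reached by \<open>E ^^ Suc e\<close> from degree \<open>d\<close>
      modulo \<open>I\<close>; the goal is \<open>w \<in> U\<close>. Being a subspace allows
      cancelling a nonzero coefficient and adding two members.\<close>
    define U where "U = {x. \<exists>y\<in>G d. x - (E ^^ Suc e) y \<in> I}"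
    have UI: "x \<in> U" if "y \<in> G d" "x - (E ^^ Suc e) y \<in> I" for x y
      using that U_def by blast
    have "subspace U"
    proof (rule subspaceI)
      show "0 \<in> U"
        by (rule UI[of 0]) (simp_all add: subspace_0[OF subspace_G] subspace_0[OF subspace_I]
            E_pow_zero del: funpow.simps)
    next
      fix x x' assume "x \<in> U" "x' \<in> U"
      then obtain y y' where y: "y \<in> G d" "y' \<in> G d" and
        I: "x - (E ^^ Suc e) y \<in> I" "x' - (E ^^ Suc e) y' \<in> I"
        unfolding U_def by blast
      show "x + x' \<in> U"
        using subspace_add[OF subspace_I I]
        by (intro UI[of "y + y'"] subspace_add[OF subspace_G] y)
          (simp add: E_pow_add algebra_simps del: funpow.simps)
    next
      fix x c assume "x \<in> U"
      then obtain y where y: "y \<in> G d" and I: "x - (E ^^ Suc e) y \<in> I"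
        unfolding U_def by blast
      show "scale c x \<in> U"
        using subspace_scale[OF subspace_I I, of c]
        by (intro UI[of "scale c y"] subspace_scale[OF subspace_G] y)
          (simp add: E_pow_scale scale_right_diff_distrib del: funpow.simps)
    qed
    have "(E ^^ Suc e) u' = (E w - (E ^^ Suc e) (E z)) - (E w - (E ^^ Suc e) u)"
      unfolding u'_def E_pow_diff by simp
    then have "(E ^^ Suc e) u' \<in> I"
      using subspace_diff[OF subspace_I z(3) Eu] by simp
    then have "(E ^^ Suc e) (F u') - F ((E ^^ Suc e) u') \<in> U"
      using subspace_neg[OF subspace_I F_I[of "(E ^^ Suc e) u'"]]
      by (intro UI[of "F u'"] F_G u') (simp del: funpow.simps)
    \<comment> \<open>\<open>u'\<close> has degree \<open>Suc d\<close>, and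
      \<open>2 * Suc d + e\<close> exceeds \<open>2 * d + Suc e\<close>, hence \<open>s\<close>, so
      the coefficient is nonzero.\<close>
    then have "(E ^^ e) u' \<in> U"
      using Suc.prems by (intro E_pow_commutator_cancel[OF u' _ \<open>subspace U\<close>]) auto
    \<comment> \<open>As \<open>u' = u - E z\<close>, this is \<open>w - (E ^^ e) u\<close>, a
      member of \<open>I\<close>, plus \<open>(E ^^ Suc e) z\<close>.\<close>
    moreover have "w - (E ^^ e) u' \<in> U"
      using u(2) z(1)
      by (intro UI[of z]) (simp_all add: u'_def E_pow_diff funpow_Suc_right del: funpow.simps)
    ultimately have "w - (E ^^ e) u' + (E ^^ e) u' \<in> U"
      using subspace_add[OF \<open>subspace U\<close>] by blast
    then show ?case by (simp add: U_def)
  qed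
qed

end

section \<open>Polynomials as a vector space and spans of monomials\<close>

abbreviation scale_poly :: "'a \<Rightarrow> 'a::field mpoly \<Rightarrow> 'a mpoly" where
  "scale_poly c f \<equiv> Poly_Mapping.single 0 c * f"

interpretation mpoly: vector_space "scale_poly :: 'a::field \<Rightarrow> 'a mpoly \<Rightarrow> 'a mpoly"
  by unfold_locales
    (simp_all add: distrib_left distrib_right single_add mult_single mult.assoc[symmetric])

lemma lookup_scale_poly: "Poly_Mapping.lookup (scale_poly c f) t = c * Poly_Mapping.lookup f t"
  unfolding mult_map_scale_conv_mult[symmetric] by (simp add: map.rep_eq when_def)

lemma poly_mapping_sum_single:
  "(\<Sum>t\<in>Poly_Mapping.keys f. Poly_Mapping.single t (Poly_Mapping.lookup f t)) = f"
  by (rule poly_mapping_eqI)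
    (auto simp: lookup_sum lookup_single when_def in_keys_iff intro!: sum.neutral)

definition monomial_span :: "monomial set \<Rightarrow> 'a::field mpoly set" where
  "monomial_span B = {f. Poly_Mapping.keys f \<subseteq> B}"

lemma single_mem_monomial_span: "t \<in> B \<or> c = 0 \<Longrightarrow> Poly_Mapping.single t c \<in> monomial_span B"
  by (auto simp: monomial_span_def)

lemma subspace_monomial_span: "mpoly.subspace (monomial_span B :: 'a::field mpoly set)"
proof (rule mpoly.subspaceI)
  show "f + g \<in> monomial_span B" if "f \<in> monomial_span B" "g \<in> monomial_span B" for f g :: "'a mpoly"
    using that Poly_Mapping.keys_add[of f g] by (auto simp: monomial_span_def)
qed (auto simp: monomial_span_def in_keys_iff lookup_scale_poly subset_iff)

text \<open>Reduces stability of graded pieces and of the ideal to single monomials. With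
  \<open>U = {0}\<close> it also proves identities between linear maps.\<close>

lemma linear_mem_if_monomials_mem:
  fixes L :: "'a::field mpoly \<Rightarrow> 'a mpoly"
  assumes L: "Vector_Spaces.linear scale_poly scale_poly L" and U: "mpoly.subspace U"
    and "\<And>t c. t \<in> B \<Longrightarrow> L (Poly_Mapping.single t c) \<in> U" and f: "f \<in> monomial_span B"
  shows "L f \<in> U"
proof -
  interpret L: Vector_Spaces.linear scale_poly scale_poly L by fact
  have "L f = (\<Sum>t\<in>Poly_Mapping.keys f. L (Poly_Mapping.single t (Poly_Mapping.lookup f t)))"
    unfolding L.sum[symmetric] poly_mapping_sum_single ..
  also have "\<dots> \<in> U"
    using assms f by (intro mpoly.subspace_sum[OF U]) (auto simp: monomial_span_def)
  finally show ?thesis .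
qed

section \<open>The lowering operator\<close>

text \<open>The quadratic q(t) = t (m - t) satisfies q(t) - q(t + 1) = 2 t - (m - 1), the weight
  wanted in one variable; the division cancels the coefficient of the linear form. The subtraction
  happens in the field and is not truncated.\<close>

definition lowering_weight :: "(nat \<Rightarrow> nat) \<Rightarrow> (nat \<Rightarrow> 'a) \<Rightarrow> nat \<Rightarrow> monomial \<Rightarrow> 'a::field" where
  "lowering_weight m a i t =
    of_nat (Poly_Mapping.lookup t i) * (of_nat (m i) - of_nat (Poly_Mapping.lookup t i)) / a i"

text \<open>
  The subtraction of exponents is truncated at \<open>lookup t i = 0\<close>, where the weight is zero.
\<close>

definition lowering :: "nat \<Rightarrow> (nat \<Rightarrow> nat) \<Rightarrow> (nat \<Rightarrow> 'a) \<Rightarrow> 'a::field mpoly \<Rightarrow> 'a mpoly" where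
  "lowering n m a f = (\<Sum>t\<in>Poly_Mapping.keys f. \<Sum>i\<in>{1..n}.
    Poly_Mapping.single (t - Poly_Mapping.single i 1)
      (lowering_weight m a i t * Poly_Mapping.lookup f t))"

lemma lowering_single:
  "lowering n m a (Poly_Mapping.single t c) =
    (\<Sum>i\<in>{1..n}. Poly_Mapping.single (t - Poly_Mapping.single i 1) (lowering_weight m a i t * c))"
  by (cases "c = 0") (simp_all add: lowering_def)

lemma linear_lowering:
  "Vector_Spaces.linear scale_poly scale_poly (lowering n m (a :: nat \<Rightarrow> 'a::field))"
proof (unfold_locales, goal_cases)
  case (1 f g)
  show ?case
    unfolding lowering_def
    by (rule setsum_keys_plus_distrib) (simp_all add: distrib_left single_add sum.distrib)
next
  case (2 c f)
  \<comment> \<open>For \<open>c = 0\<close> scaling loses keys; summing over the keys of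
    \<open>f\<close> only adds zero terms.\<close>
  have "lowering n m a (scale_poly c f) = (\<Sum>t\<in>Poly_Mapping.keys f. \<Sum>i\<in>{1..n}.
    Poly_Mapping.single (t - Poly_Mapping.single i 1)
      (lowering_weight m a i t * Poly_Mapping.lookup (scale_poly c f) t))"
    unfolding lowering_def
    by (intro sum.mono_neutral_left) (auto simp: in_keys_iff lookup_scale_poly)
  also have "\<dots> = scale_poly c (lowering n m a f)"
    by (simp add: lowering_def sum_distrib_left mult_single lookup_scale_poly mult.left_commute)
  finally show ?case .
qed

lemma linear_mult: "Vector_Spaces.linear scale_poly scale_poly ((*) (l :: 'a::field mpoly))"
  by unfold_locales (simp_all add: algebra_simps)

section \<open>Exponents and degrees of monomials\<close>

definition monomials :: "nat \<Rightarrow> monomial set" where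
  "monomials n = {t. Poly_Mapping.keys t \<subseteq> {1..n}}"

lemma total_degree_eq_sum:
  "t \<in> monomials n \<Longrightarrow> total_degree t = (\<Sum>i\<in>{1..n}. Poly_Mapping.lookup t i)"
  unfolding total_degree_def monomials_def
  by (intro sum.mono_neutral_left) (auto simp: in_keys_iff)

lemma raise_mem_monomials:
  "t \<in> monomials n \<Longrightarrow> i \<in> {1..n} \<Longrightarrow> Poly_Mapping.single i 1 + t \<in> monomials n"
  by (auto simp: monomials_def in_keys_iff lookup_add lookup_single when_def subset_iff)

lemma lower_mem_monomials:
  "t \<in> monomials n \<Longrightarrow> t - Poly_Mapping.single i 1 \<in> monomials n"
  by (auto simp: monomials_def in_keys_iff lookup_minus subset_iff)

lemma lower_raise:
  "0 < Poly_Mapping.lookup t i \<Longrightarrow>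
    Poly_Mapping.single i 1 + (t - Poly_Mapping.single i 1) = (t :: monomial)"
  by (rule poly_mapping_eqI) (auto simp: lookup_add lookup_minus lookup_single when_def)

lemma total_degree_raise:
  assumes "t \<in> monomials n" "i \<in> {1..n}"
  shows "total_degree (Poly_Mapping.single i 1 + t) = Suc (total_degree t)"
proof -
  have "(\<Sum>j\<in>{1..n}. Poly_Mapping.lookup (Poly_Mapping.single i (1::nat)) j) = 1"
    using assms(2) by (simp add: lookup_single when_def)
  then show ?thesis
    unfolding total_degree_eq_sum[OF assms(1)] total_degree_eq_sum[OF raise_mem_monomials[OF assms]]
    by (simp add: lookup_add sum.distrib del: One_nat_def)
qed

lemma total_degree_lower:
  assumes "t \<in> monomials n" "i \<in> {1..n}" "0 < Poly_Mapping.lookup t i"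
  shows "Suc (total_degree (t - Poly_Mapping.single i 1)) = total_degree t"
  using total_degree_raise[OF lower_mem_monomials[OF assms(1)] assms(2), of i]
    lower_raise[OF assms(3)] by simp

section \<open>Both operators on the graded pieces and on the ideal\<close>

abbreviation graded_polys :: "nat \<Rightarrow> nat \<Rightarrow> 'a::field mpoly set" where
  "graded_polys n d \<equiv> monomial_span {t \<in> monomials n. total_degree t = d}"

text \<open>The ideal in a form where stability can be checked on monomials;
  \<open>monomial_ci_ideal_eq_ci_span\<close> justifies it.\<close>

abbreviation ci_span :: "nat \<Rightarrow> (nat \<Rightarrow> nat) \<Rightarrow> 'a::field mpoly set" where
  "ci_span n m \<equiv> monomial_span {t \<in> monomials n. \<exists>i\<in>{1..n}. m i \<le> Poly_Mapping.lookup t i}"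

lemma linear_form_mult_single:
  "linear_form n a * Poly_Mapping.single t c =
    (\<Sum>i\<in>{1..n}. Poly_Mapping.single (Poly_Mapping.single i 1 + t) (a i * c))"
  by (simp add: linear_form_def sum_distrib_right mult_single)

lemma linear_form_mult_graded:
  assumes "f \<in> graded_polys n d"
  shows "linear_form n a * f \<in> graded_polys n (Suc d)"
proof (rule linear_mem_if_monomials_mem[OF linear_mult subspace_monomial_span _ assms])
  fix t c assume "t \<in> {t \<in> monomials n. total_degree t = d}"
  then show "linear_form n a * Poly_Mapping.single t c \<in> graded_polys n (Suc d)"
    unfolding linear_form_mult_single
    by (intro mpoly.subspace_sum subspace_monomial_span single_mem_monomial_span)
      (simp add: raise_mem_monomials total_degree_raise[of _ n] del: One_nat_def)
qed

lemma linear_form_mult_ci_span: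
  assumes "f \<in> ci_span n m"
  shows "linear_form n a * f \<in> ci_span n m"
proof (rule linear_mem_if_monomials_mem[OF linear_mult subspace_monomial_span _ assms])
  fix t c assume t: "t \<in> {t \<in> monomials n. \<exists>i\<in>{1..n}. m i \<le> Poly_Mapping.lookup t i}"
  then obtain j where "j \<in> {1..n}" "m j \<le> Poly_Mapping.lookup t j" by blast
  then have "m j \<le> Poly_Mapping.lookup (Poly_Mapping.single i 1 + t) j" for i
    by (simp add: lookup_add trans_le_add2)
  then have "Poly_Mapping.single i 1 + t \<in>
      {t \<in> monomials n. \<exists>i\<in>{1..n}. m i \<le> Poly_Mapping.lookup t i}" if "i \<in> {1..n}" for i
    using that t \<open>j \<in> {1..n}\<close> raise_mem_monomials[of t n i] by blast
  then show "linear_form n a * Poly_Mapping.single t c \<in> ci_span n m"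
    unfolding linear_form_mult_single
    by (intro mpoly.subspace_sum subspace_monomial_span single_mem_monomial_span)
      blast
qed

lemma lowering_graded:
  assumes "f \<in> graded_polys n (Suc d)"
  shows "lowering n m a f \<in> graded_polys n d"
proof (rule linear_mem_if_monomials_mem[OF linear_lowering subspace_monomial_span _ assms])
  fix t c assume t: "t \<in> {t \<in> monomials n. total_degree t = Suc d}"
  have "t - Poly_Mapping.single i 1 \<in> {t \<in> monomials n. total_degree t = d} \<or>
      lowering_weight m a i t * c = 0" if "i \<in> {1..n}" for i
    using t that total_degree_lower[of t n i] lower_mem_monomials[of t n i]
    by (cases "Poly_Mapping.lookup t i = 0") (auto simp: lowering_weight_def)
  then show "lowering n m a (Poly_Mapping.single t c) \<in> graded_polys n d"
    unfolding lowering_single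
    by (intro mpoly.subspace_sum subspace_monomial_span single_mem_monomial_span)
qed

lemma lowering_graded_0:
  assumes "f \<in> graded_polys n 0"
  shows "lowering n m a f = 0"
proof -
  have "lowering n m a f \<in> {0}"
  proof (rule linear_mem_if_monomials_mem[OF linear_lowering mpoly.subspace_single_0 _ assms])
    fix t c assume "t \<in> {t \<in> monomials n. total_degree t = 0}"
    then have "\<forall>i\<in>{1..n}. Poly_Mapping.lookup t i = 0"
      using total_degree_eq_sum[of t n] by simp
    then show "lowering n m a (Poly_Mapping.single t c) \<in> {0}"
      by (simp add: lowering_single lowering_weight_def)
  qed
  then show ?thesis by simp
qed

text \<open>The weight vanishes where lowering would leave the ideal, at exponent \<open>m i\<close>.\<close>

lemma lowering_ci_span:
  assumes "f \<in> ci_span n m"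
  shows "lowering n m a f \<in> ci_span n m"
proof (rule linear_mem_if_monomials_mem[OF linear_lowering subspace_monomial_span _ assms])
  fix t c assume t: "t \<in> {t \<in> monomials n. \<exists>i\<in>{1..n}. m i \<le> Poly_Mapping.lookup t i}"
  then obtain j where j: "j \<in> {1..n}" "m j \<le> Poly_Mapping.lookup t j" by blast
  have "t - Poly_Mapping.single i 1 \<in> {t \<in> monomials n. \<exists>i\<in>{1..n}. m i \<le> Poly_Mapping.lookup t i} \<or>
      lowering_weight m a i t * c = 0" if "i \<in> {1..n}" for i
  proof (cases "i = j \<and> m j = Poly_Mapping.lookup t j")
    case True
    then show ?thesis by (simp add: lowering_weight_def)
  next
    case False
    then have "m j \<le> Poly_Mapping.lookup (t - Poly_Mapping.single i 1) j"
      using j by (auto simp: lookup_minus lookup_single when_def)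
    then show ?thesis using j t lower_mem_monomials[of t n i] by blast
  qed
  then show "lowering n m a (Poly_Mapping.single t c) \<in> ci_span n m"
    unfolding lowering_single
    by (intro mpoly.subspace_sum subspace_monomial_span single_mem_monomial_span)
qed

text \<open>A monomial outside the span has every exponent at most \<open>m i - 1\<close>, which
  bounds its degree by the sum.\<close>

lemma graded_subset_ci_span:
  assumes "(\<Sum>i\<in>{1..n}. m i - 1) < d"
  shows "graded_polys n d \<subseteq> ci_span n m"
proof -
  have "\<exists>i\<in>{1..n}. m i \<le> Poly_Mapping.lookup t i" if t: "t \<in> monomials n" "total_degree t = d" for t
  proof (rule ccontr)
    assume "\<not> ?thesis"
    then have "total_degree t \<le> (\<Sum>i\<in>{1..n}. m i - 1)"
      unfolding total_degree_eq_sum[OF t(1)] by (intro sum_mono) (simp add: not_le less_eq_Suc_le, force)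
    with assms t show False by simp
  qed
  then show ?thesis by (auto simp: monomial_span_def)
qed

section \<open>The commutator relation\<close>

text \<open>Raising in one variable commutes with lowering in another, because the weight sees only
  the exponent being lowered. The diagonal terms contribute 2 t_i - (m_i - 1) each.\<close>

lemma commutator_single:
  fixes a :: "nat \<Rightarrow> 'a::field"
  assumes t: "t \<in> monomials n"
    and a: "\<And>i. i \<in> {1..n} \<Longrightarrow> a i \<noteq> 0" and m: "\<And>i. i \<in> {1..n} \<Longrightarrow> 1 \<le> m i"
  shows "linear_form n a * lowering n m a (Poly_Mapping.single t c) -
      lowering n m a (linear_form n a * Poly_Mapping.single t c) =
    scale_poly (2 * of_nat (total_degree t) - of_nat (\<Sum>i\<in>{1..n}. m i - 1)) (Poly_Mapping.single t c)"
proof -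
  let ?e = "\<lambda>i. Poly_Mapping.single i (1::nat)" and ?w = "lowering_weight m a"
  interpret L: Vector_Spaces.linear scale_poly scale_poly "lowering n m a" by (rule linear_lowering)
  \<comment> \<open>\<open>X j i\<close> lowers at \<open>i\<close> and then raises at
    \<open>j\<close>; \<open>Y j i\<close> raises first.\<close>
  define X where "X j i = Poly_Mapping.single (?e j + (t - ?e i)) (a j * (?w i t * c))" for i j
  define Y where "Y j i = Poly_Mapping.single ((?e j + t) - ?e i) (?w i (?e j + t) * (a j * c))" for i j
  let ?h = "\<lambda>i. 2 * of_nat (Poly_Mapping.lookup t i) - of_nat (m i - 1) :: 'a"
  have X: "linear_form n a * lowering n m a (Poly_Mapping.single t c) = (\<Sum>i\<in>{1..n}. \<Sum>j\<in>{1..n}. X j i)"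
    unfolding lowering_single sum_distrib_left linear_form_mult_single X_def ..
  have Y: "lowering n m a (linear_form n a * Poly_Mapping.single t c) = (\<Sum>i\<in>{1..n}. \<Sum>j\<in>{1..n}. Y j i)"
    unfolding linear_form_mult_single L.sum lowering_single Y_def by (rule sum.swap)
  have off_diagonal: "X j i = Y j i" if "i \<noteq> j" for i j
  proof -
    have w: "?w i (?e j + t) = ?w i t"
      using that by (simp add: lowering_weight_def lookup_add lookup_single when_def)
    show ?thesis
    proof (cases "Poly_Mapping.lookup t i = 0")
      case True
      then have "?w i t = 0" by (simp add: lowering_weight_def)
      then show ?thesis unfolding X_def Y_def w by simp
    next
      case False
      then have "?e j + (t - ?e i) = (?e j + t) - ?e i"
        by (intro poly_mapping_eqI) (auto simp: lookup_add lookup_minus lookup_single when_def)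
      then show ?thesis unfolding X_def Y_def w by (simp add: mult_ac)
    qed
  qed
  have diagonal: "X i i - Y i i = Poly_Mapping.single t (?h i * c)" if i: "i \<in> {1..n}" for i
  proof -
    \<comment> \<open>At exponent 0 truncated lowering followed by raising does not return to
      \<open>t\<close>, but both sides are zero with the weight.\<close>
    have "X i i = Poly_Mapping.single t (a i * ?w i t * c)"
    proof (cases "Poly_Mapping.lookup t i = 0")
      case True
      then show ?thesis by (simp add: X_def lowering_weight_def)
    next
      case False
      then show ?thesis using lower_raise[of t i] by (simp add: X_def mult_ac)
    qed
    moreover have "Y i i = Poly_Mapping.single t (a i * ?w i (?e i + t) * c)"
      by (simp add: Y_def mult_ac)
    ultimately have XY: "X i i - Y i i = Poly_Mapping.single t ((a i * ?w i t - a i * ?w i (?e i + t)) * c)"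
      by (simp only: single_diff left_diff_distrib)
    have weight: "a i * ?w i t' = of_nat (Poly_Mapping.lookup t' i) *
        (of_nat (m i) - of_nat (Poly_Mapping.lookup t' i))" for t'
      using a[OF i] by (simp add: lowering_weight_def)
    \<comment> \<open>\<open>1 \<le> m i\<close> makes the truncated \<open>m i - 1\<close> agree
      with subtraction in the field.\<close>
    have "a i * ?w i t - a i * ?w i (?e i + t) = ?h i"
      unfolding weight using m[OF i] by (simp add: lookup_add of_nat_diff algebra_simps)
    then show ?thesis unfolding XY by simp
  qed
  have "(\<Sum>j\<in>{1..n}. X j i - Y j i) = Poly_Mapping.single t (?h i * c)" if "i \<in> {1..n}" for i
    using that diagonal[OF that] off_diagonal[of i]
    by (subst sum.remove[of _ i]) (auto intro!: sum.neutral)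
  then have "(\<Sum>i\<in>{1..n}. \<Sum>j\<in>{1..n}. X j i - Y j i) = (\<Sum>i\<in>{1..n}. Poly_Mapping.single t (?h i * c))"
    by (intro sum.cong) simp_all
  also have "\<dots> = scale_poly (\<Sum>i\<in>{1..n}. ?h i) (Poly_Mapping.single t c)"
    unfolding mpoly.scale_sum_left by (simp only: mult_single add_0)
  also have "(\<Sum>i\<in>{1..n}. ?h i) = 2 * of_nat (total_degree t) - of_nat (\<Sum>i\<in>{1..n}. m i - 1)"
    unfolding total_degree_eq_sum[OF t] sum_subtractf of_nat_sum sum_distrib_left ..
  finally show ?thesis unfolding X Y by (simp only: sum_subtractf)
qed

lemma commutator_graded:
  fixes a :: "nat \<Rightarrow> 'a::field"
  assumes f: "f \<in> graded_polys n d"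
    and a: "\<And>i. i \<in> {1..n} \<Longrightarrow> a i \<noteq> 0" and m: "\<And>i. i \<in> {1..n} \<Longrightarrow> 1 \<le> m i"
  shows "linear_form n a * lowering n m a f - lowering n m a (linear_form n a * f) =
    scale_poly (2 * of_nat d - of_nat (\<Sum>i\<in>{1..n}. m i - 1)) f"
proof -
  let ?c = "2 * of_nat d - of_nat (\<Sum>i\<in>{1..n}. m i - 1) :: 'a"
  let ?D = "\<lambda>f. linear_form n a * lowering n m a f - lowering n m a (linear_form n a * f) - scale_poly ?c f"
  interpret L: Vector_Spaces.linear scale_poly scale_poly "lowering n m a" by (rule linear_lowering)
  interpret M: Vector_Spaces.linear scale_poly scale_poly "(*) (linear_form n a)" by (rule linear_mult)
  have "Vector_Spaces.linear scale_poly scale_poly ?D"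
    by unfold_locales
      (simp_all add: L.add L.scale M.scale distrib_left right_diff_distrib mpoly.scale_left_commute
        del: mpoly.scale_scale)
  then have "?D f \<in> {0}"
    by (rule linear_mem_if_monomials_mem[OF _ mpoly.subspace_single_0 _ f])
      (auto simp only: commutator_single[OF _ a m] mem_Collect_eq diff_self)
  then show ?thesis by simp
qed

lemma lefschetz_sl2_monomial_ci:
  fixes a :: "nat \<Rightarrow> 'a::field_char_0"
  assumes a: "\<And>i. i \<in> {1..n} \<Longrightarrow> a i \<noteq> 0" and m: "\<And>i. i \<in> {1..n} \<Longrightarrow> 1 \<le> m i"
  shows "lefschetz_sl2 scale_poly ((*) (linear_form n a)) (lowering n m a)
    (graded_polys n) (ci_span n m) (\<Sum>i\<in>{1..n}. m i - 1)"
proof -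
  interpret L: Vector_Spaces.linear scale_poly scale_poly "lowering n m a" by (rule linear_lowering)
  interpret M: Vector_Spaces.linear scale_poly scale_poly "(*) (linear_form n a)" by (rule linear_mult)
  have commutator: "linear_form n a * lowering n m a f - lowering n m a (linear_form n a * f) =
      scale_poly (2 * of_nat d - of_nat (\<Sum>i\<in>{1..n}. m i - 1)) f"
    if "f \<in> graded_polys n d" for f d
    using commutator_graded[OF that a m] .
  show ?thesis
    by unfold_locales
      (fact subspace_monomial_span linear_form_mult_ci_span lowering_ci_span linear_form_mult_graded
        lowering_graded lowering_graded_0 commutator graded_subset_ci_span)+
qed

section \<open>The ring and the ideal in terms of monomials\<close>

lemma poly_ring_simps:
  "carrier (poly_ring n) = (monomial_span (monomials n) :: 'a::field mpoly set)"
  "x \<oplus>\<^bsub>poly_ring n\<^esub> y = x + (y :: 'a::field mpoly)"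
  "x \<otimes>\<^bsub>poly_ring n\<^esub> y = x * (y :: 'a::field mpoly)"
  "\<zero>\<^bsub>poly_ring n\<^esub> = (0 :: 'a::field mpoly)"
  "\<one>\<^bsub>poly_ring n\<^esub> = (1 :: 'a::field mpoly)"
  by (auto simp: poly_ring_def monomial_span_def monomials_def)

lemma poly_ring_uminus:
  assumes "f \<in> carrier (poly_ring n)"
  shows "\<ominus>\<^bsub>poly_ring n\<^esub> f = - (f :: 'a::field mpoly)"
proof -
  interpret cring "poly_ring n :: 'a mpoly ring" by (rule cring_poly_ring)
  have "- f \<in> carrier (poly_ring n)"
    using assms mpoly.subspace_neg[OF subspace_monomial_span] by (simp add: poly_ring_simps)
  then show ?thesis
    using assms by (intro minus_equality) (simp_all add: poly_ring_simps)
qed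

lemma poly_ring_minus:
  assumes "g \<in> carrier (poly_ring n)"
  shows "f \<ominus>\<^bsub>poly_ring n\<^esub> g = f - (g :: 'a::field mpoly)"
  using assms by (simp add: a_minus_def poly_ring_uminus poly_ring_simps)

lemma single_mem_monomial_ci_ideal:
  assumes t: "t \<in> monomials n" and i: "i \<in> {1..n}" "m i \<le> Poly_Mapping.lookup t i"
  shows "Poly_Mapping.single t c \<in> (monomial_ci_ideal n m :: 'a::field mpoly set)"
proof -
  interpret cring "poly_ring n :: 'a mpoly ring" by (rule cring_poly_ring)
  interpret ideal "monomial_ci_ideal n m :: 'a mpoly set" "poly_ring n"
    by (rule ideal_monomial_ci_ideal)
  let ?s = "Poly_Mapping.single i (m i)"
  have "?s + (t - ?s) = t"
    using i(2) by (intro poly_mapping_eqI) (auto simp: lookup_add lookup_minus lookup_single when_def)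
  then have "Poly_Mapping.single t c = var_power i (m i) * Poly_Mapping.single (t - ?s) c"
    by (simp add: var_power_def mult_single)
  moreover have "t - ?s \<in> monomials n"
    using t by (auto simp: monomials_def in_keys_iff lookup_minus subset_iff)
  then have "Poly_Mapping.single (t - ?s) c \<in> carrier (poly_ring n)"
    unfolding poly_ring_simps by (intro single_mem_monomial_span) simp
  moreover have "var_power i (m i) \<in> (monomial_ci_ideal n m :: 'a mpoly set)"
    unfolding monomial_ci_ideal_def
    using i by (intro subsetD[OF genideal_self]) (auto simp: poly_ring_def var_power_def split: if_splits)
  ultimately show ?thesis using I_r_closed by (simp add: poly_ring_simps)
qed

text \<open>One inclusion assembles a polynomial from its terms inside the ideal; the other holds
  because the span is itself an ideal containing the generators.\<close>

lemma monomial_ci_ideal_eq_ci_span: "monomial_ci_ideal n m = (ci_span n m :: 'a::field mpoly set)"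
proof
  interpret cring "poly_ring n :: 'a mpoly ring" by (rule cring_poly_ring)
  interpret I: ideal "monomial_ci_ideal n m :: 'a mpoly set" "poly_ring n"
    by (rule ideal_monomial_ci_ideal)
  show "ci_span n m \<subseteq> (monomial_ci_ideal n m :: 'a mpoly set)"
  proof
    fix f :: "'a mpoly" assume f: "f \<in> ci_span n m"
    have "(\<Sum>t\<in>T. Poly_Mapping.single t (Poly_Mapping.lookup f t)) \<in> monomial_ci_ideal n m"
      if "finite T" "T \<subseteq> Poly_Mapping.keys f" for T
      using that
    proof (induction T)
      case empty
      then show ?case using I.zero_closed by (simp add: poly_ring_simps)
    next
      case (insert t T)
      then have "t \<in> monomials n" "\<exists>i\<in>{1..n}. m i \<le> Poly_Mapping.lookup t i"
        using f unfolding monomial_span_def by blast+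
      then have "Poly_Mapping.single t (Poly_Mapping.lookup f t) \<in> monomial_ci_ideal n m"
        using single_mem_monomial_ci_ideal by blast
      then show ?case using insert I.a_closed by (simp add: poly_ring_simps)
    qed
    from this[of "Poly_Mapping.keys f"] show "f \<in> monomial_ci_ideal n m"
      by (simp add: poly_mapping_sum_single)
  qed
  have mult: "f * g \<in> ci_span n m" if "f \<in> monomial_span (monomials n)" "g \<in> ci_span n m"
    for f g :: "'a mpoly"
  proof -
    have "r + s \<in> {t \<in> monomials n. \<exists>i\<in>{1..n}. m i \<le> Poly_Mapping.lookup t i}"
      if "r \<in> Poly_Mapping.keys f" "s \<in> Poly_Mapping.keys g" for r s
      using that \<open>f \<in> _\<close> \<open>g \<in> _\<close> Poly_Mapping.keys_add[of r s]
      by (fastforce simp: monomial_span_def monomials_def lookup_add intro: trans_le_add2)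
    then show ?thesis
      using Poly_Mapping.keys_mult[of f g] by (auto simp: monomial_span_def)
  qed
  have "ideal (ci_span n m :: 'a mpoly set) (poly_ring n)"
  proof (rule idealI[OF ring_axioms])
    show "subgroup (ci_span n m :: 'a mpoly set) (add_monoid (poly_ring n))"
    proof (rule add.subgroupI)
      show "\<ominus>\<^bsub>poly_ring n\<^esub> f \<in> ci_span n m" if f: "f \<in> ci_span n m" for f :: "'a mpoly"
      proof -
        have "f \<in> carrier (poly_ring n)" using f by (auto simp: poly_ring_simps monomial_span_def)
        then have "\<ominus>\<^bsub>poly_ring n\<^esub> f = - f" by (rule poly_ring_uminus)
        then show ?thesis using f mpoly.subspace_neg[OF subspace_monomial_span] by simp
      qed
    qed (auto simp: poly_ring_simps monomial_span_def intro!: exI[of _ 0]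
        dest: subsetD[OF Poly_Mapping.keys_add])
    show "x \<otimes>\<^bsub>poly_ring n\<^esub> f \<in> ci_span n m" "f \<otimes>\<^bsub>poly_ring n\<^esub> x \<in> ci_span n m"
      if "f \<in> ci_span n m" "x \<in> carrier (poly_ring n)" for f x :: "'a mpoly"
      using mult[of x f] that by (simp_all add: poly_ring_simps mult.commute)
  qed
  then show "monomial_ci_ideal n m \<subseteq> (ci_span n m :: 'a mpoly set)"
    unfolding monomial_ci_ideal_def
    by (rule genideal_minimal)
      (auto simp: var_power_def monomials_def intro!: single_mem_monomial_span split: if_splits,
        metis atLeastAtMost_iff lookup_single_eq One_nat_def order_refl)
qed

lemma graded_polys_eq: "graded_polys n d = {f \<in> carrier (poly_ring n). homogeneous d f}"
  by (auto simp: poly_ring_simps monomial_span_def homogeneous_def)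

section \<open>Transfer to the quotient ring\<close>

text \<open>Cosets agree iff representatives differ by an element of \<open>I\<close>, so maximal
  rank becomes \<open>E_pow_inj_mod\<close> or \<open>E_pow_surj_mod\<close>, according to whether
  \<open>2 * d + e\<close> is at most the top degree.\<close>

lemma strong_lefschetz_element_monomial_ci:
  fixes a :: "nat \<Rightarrow> 'a::field_char_0"
  assumes a: "\<And>i. i \<in> {1..n} \<Longrightarrow> a i \<noteq> 0" and m: "\<And>i. i \<in> {1..n} \<Longrightarrow> 1 \<le> m i"
  shows "strong_lefschetz_element n (monomial_ci_ideal n m) (linear_form n a)"
proof -
  let ?R = "poly_ring n :: 'a mpoly ring"
  let ?l = "linear_form n a"
  define I where "I = (monomial_ci_ideal n m :: 'a mpoly set)"
  interpret cring ?R by (rule cring_poly_ring)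
  interpret I: ideal I ?R unfolding I_def by (rule ideal_monomial_ci_ideal)
  interpret S: lefschetz_sl2 scale_poly "(*) ?l" "lowering n m a" "graded_polys n" I
      "\<Sum>i\<in>{1..n}. m i - 1"
    unfolding I_def monomial_ci_ideal_eq_ci_span by (rule lefschetz_sl2_monomial_ci[OF a m])
  have coset_eq: "I +>\<^bsub>?R\<^esub> f = I +>\<^bsub>?R\<^esub> g \<longleftrightarrow> f - g \<in> I"
    if "f \<in> carrier ?R" "g \<in> carrier ?R" for f g
    using quotient_eq_iff_same_a_r_cos[OF I.is_ideal that] poly_ring_minus[OF that(2)] by simp
  have G_carrier: "f \<in> carrier ?R" if "f \<in> graded_polys n d" for f d
    using that by (simp add: graded_polys_eq)
  have l: "?l \<in> carrier ?R"
    unfolding poly_ring_simps linear_form_def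
    by (intro mpoly.subspace_sum subspace_monomial_span single_mem_monomial_span)
      (simp add: monomials_def)
  have E_pow: "((*) ?l ^^ e) f = ?l ^ e * f" for e f
    by (induction e) (simp_all add: mult.assoc)
  \<comment> \<open>Closure is proved together with the formula, since multiplicativity of the coset
    map needs \<open>?l ^ e\<close> in the carrier.\<close>
  have pow: "?l ^ e \<in> carrier ?R \<and>
      (I +>\<^bsub>?R\<^esub> ?l) [^]\<^bsub>?R Quot I\<^esub> e = I +>\<^bsub>?R\<^esub> (?l ^ e)" for e :: nat
  proof (induction e)
    case 0
    then show ?case
      using ring_hom_one[OF I.rcos_ring_hom] one_closed by (simp add: poly_ring_simps)
  next
    case (Suc e)
    then show ?case
      using ring_hom_mult[OF I.rcos_ring_hom _ l, of "?l ^ e"] m_closed[OF _ l, of "?l ^ e"]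
      by (simp add: poly_ring_simps mult.commute)
  qed
  have act: "(I +>\<^bsub>?R\<^esub> ?l) [^]\<^bsub>?R Quot I\<^esub> e \<otimes>\<^bsub>?R Quot I\<^esub> (I +>\<^bsub>?R\<^esub> f) =
      I +>\<^bsub>?R\<^esub> ((*) ?l ^^ e) f" if "f \<in> carrier ?R" for e f
    using ring_hom_mult[OF I.rcos_ring_hom _ that, of "?l ^ e"] pow[of e]
    by (simp add: poly_ring_simps E_pow)
  have piece: "graded_piece n I d = (\<lambda>f. I +>\<^bsub>?R\<^esub> f) ` graded_polys n d" for d
    unfolding graded_piece_def graded_polys_eq by blast
  have "maximal_rank (\<lambda>u. (I +>\<^bsub>?R\<^esub> ?l) [^]\<^bsub>?R Quot I\<^esub> e \<otimes>\<^bsub>?R Quot I\<^esub> u)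
      (graded_piece n I d) (graded_piece n I (d + e))" (is "maximal_rank ?\<phi> _ _") for d e
  proof (cases "2 * d + e \<le> (\<Sum>i\<in>{1..n}. m i - 1)")
    case True
    have "I +>\<^bsub>?R\<^esub> f = I +>\<^bsub>?R\<^esub> g"
      if f: "f \<in> graded_polys n d" and g: "g \<in> graded_polys n d"
        and eq: "?\<phi> (I +>\<^bsub>?R\<^esub> f) = ?\<phi> (I +>\<^bsub>?R\<^esub> g)" for f g
    proof -
      have "((*) ?l ^^ e) (f - g) \<in> I"
        using eq coset_eq[OF G_carrier G_carrier, OF S.E_pow_G S.E_pow_G, OF f g]
        unfolding act[OF G_carrier[OF f]] act[OF G_carrier[OF g]] S.E_pow_diff by blast
      then have "f - g \<in> I"
        by (rule S.E_pow_inj_mod[OF mpoly.subspace_diff[OF S.subspace_G f g] True])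
      then show ?thesis using coset_eq[OF G_carrier[OF f] G_carrier[OF g]] by simp
    qed
    then show ?thesis unfolding maximal_rank_def piece by (auto intro!: inj_onI)
  next
    case False
    have "?\<phi> ` graded_piece n I d = graded_piece n I (d + e)"
    proof
      show "?\<phi> ` graded_piece n I d \<subseteq> graded_piece n I (d + e)"
        using S.E_pow_G by (auto simp: piece act[OF G_carrier])
      show "graded_piece n I (d + e) \<subseteq> ?\<phi> ` graded_piece n I d"
      proof
        fix u assume "u \<in> graded_piece n I (d + e)"
        then obtain w where w: "w \<in> graded_polys n (d + e)" "u = I +>\<^bsub>?R\<^esub> w"
          unfolding piece by blast
        obtain f where f: "f \<in> graded_polys n d" "w - ((*) ?l ^^ e) f \<in> I"
          using S.E_pow_surj_mod[OF w(1)] False by auto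
        then have "u = ?\<phi> (I +>\<^bsub>?R\<^esub> f)"
          using coset_eq[OF G_carrier[OF w(1)] G_carrier[OF S.E_pow_G[OF f(1)]]]
          unfolding w(2) act[OF G_carrier[OF f(1)]] by blast
        then show "u \<in> ?\<phi> ` graded_piece n I d"
          using f(1) unfolding piece by blast
      qed
    qed
    then show ?thesis unfolding maximal_rank_def by blast
  qed
  then show ?thesis
    unfolding strong_lefschetz_element_def Let_def I_def by blast
qed

theorem corollary4p6:
  fixes n :: nat and m :: "nat \<Rightarrow> nat"
  assumes "n \<ge> 1"
    and "\<And>i. i \<in> {1..n} \<Longrightarrow> m i \<ge> 2"
  shows "strong_lefschetz_property n (monomial_ci_ideal n m :: 'k::field_char_0 mpoly set)"
proof -
  \<comment> \<open>\<open>?F\<close> is the product of all variables: it is nonzero exactly at the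
    linear forms with no zero coefficient.\<close>
  let ?t = "\<Sum>i\<in>{1..n}. Poly_Mapping.single i (1::nat)"
  let ?F = "Poly_Mapping.single ?t 1 :: 'k mpoly"
  have lookup: "Poly_Mapping.lookup ?t i = (if i \<in> {1..n} then 1 else 0)" for i
    by (simp add: lookup_sum lookup_single when_def)
  have keys: "Poly_Mapping.keys ?t = {1..n}"
    by (auto simp only: in_keys_iff lookup split: if_splits)
  have eval: "eval_poly a ?F = (\<Prod>i\<in>{1..n}. a i)" for a
    unfolding eval_poly_def by (simp add: keys lookup del: One_nat_def)
  have "?F \<in> carrier (poly_ring n)"
    by (simp add: poly_ring_def keys del: One_nat_def)
  \<comment> \<open>The sum of the variables shows that this open set is nonempty.\<close>
  moreover have "eval_poly (\<lambda>_. 1) ?F \<noteq> 0"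
    unfolding eval by simp
  moreover have "strong_lefschetz_element n (monomial_ci_ideal n m) (linear_form n a)"
    if "eval_poly a ?F \<noteq> 0" for a
  proof (rule strong_lefschetz_element_monomial_ci)
    show "a i \<noteq> 0" if "i \<in> {1..n}" for i
      using \<open>eval_poly a ?F \<noteq> 0\<close> that unfolding eval by auto
    show "1 \<le> m i" if "i \<in> {1..n}" for i
      using assms(2)[OF that] by simp
  qed
  ultimately show ?thesis
    unfolding strong_lefschetz_property_def for_general_linear_form_def by blast
qed

end
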